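(* Let $n\ge2$, $p>n$, let $\Omega\subset\mathbb R^n$ be a bounded connected $C^{1,\mathrm{Dini}}$ domain, and let $V\in L^p(\Omega)$. Let $r_{\mathrm{fix}}:=2r_d$, where $r_d$ is the dyadic recentering scale of $\Omega$ described in the context (which satisfies $r_d/32\le r_*$ and $r_d/4\le1$). Assume that $u\in W^{1,2}_0(\Omega)$ is a nontrivial global Dirichlet solution, i.e. a nontrivial weak solution of $\Delta u+V(x)u=0$ in $\Omega$. Then $$\mathcal D_{\mathrm{fix}}(u):=\sup_{y\in\overline\Omega}\log_4\frac{\operatorname{avg}_{\Omega\cap B_{2r_{\mathrm{fix}}}(y)}u^2}{\operatorname{avg}_{\Omega\cap B_{r_{\mathrm{fix}}}(y)}u^2}\le C(n,p,\Omega)\left(1+\|V\|_{L^p(\Omega)}^{\frac{2p}{3p-2n}}\right).$$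
   Context: $\operatorname{avg}_E f=\frac1{|E|}\int_E f$. A bounded domain $\Omega$ is $C^{1,\mathrm{Dini}}$ if there are $r_\Omega>0$, $L_\Omega<\infty$ and a nondecreasing modulus $\omega_{\partial\Omega}$ with $\int_0^{r_\Omega}\frac{\omega_{\partial\Omega}(t)}t\,dt<\infty$ such that at every boundary point, after a rigid motion taking it to $0$, $\Omega\cap B_{r_\Omega}=\{(x',x_n):x_n>\varphi(x')\}\cap B_{r_\Omega}$ with $\varphi(0)=0$, $\nabla\varphi(0)=0$, $\|\nabla\varphi\|_{L^\infty}\le L_\Omega$ and $|\nabla\varphi(x')-\nabla\varphi(y')|\le\omega_{\partial\Omega}(|x'-y'|)$. The radius $r_*=r_*(\Omega)>0$ is such that for every $y\in\overline\Omega$ and $0<r\le r_*$ there is a point $y_r\in\Omega$ with $|y_r-y|\le C_\Omega r\,\omega_{\partial\Omega}(C_\Omega r)\le r/32$ for which $\Omega\cap B_{8r}(y_r)$ is star-shaped with respect to $y_r$ (and consequently $\Omega\cap B_{31r/32}(y_r)\subset\Omega\cap B_r(y)\subset\Omega\cap B_{33r/32}(y_r)$). The dyadic recentering scale $r_d=r_d(n,p,\Omega)>0$ is a scale with the following property, for a constant $C=C(n,p,\Omega)$: for every nontrivial weak solution $u\in W^{1,2}_0(\Omega)$ of $\Delta u+Vu=0$ with $V\in L^p(\Omega)$, writing $S_y(r):=\log\frac{\int_{\Omega\cap B_r(y)}u^2}{\int_{\Omega\cap B_{r/2}(y)}u^2}$, one has, for every $y\in\overline\Omega$ and $0<r\le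 r_d$, $$\sup_{0<s\le r}S_y(s)\le C\left[1+\|V\|_{L^p(\Omega)}^{\frac{2p}{3p-2n}}+S_y(4r)\right].$$ It is moreover decreased, depending only on the quantitative $C^{1,\mathrm{Dini}}$ character of $\Omega$ (the data of the boundary charts), so that $r_d/32\le r_*$ and $r_d/4\le1$. The existence of $r_*$ and $r_d$ is established in the paper. *)

theory Defs
  imports "HOL-Analysis.Analysis"
begin

section \<open>Test functions\<close>

definition grad :: "('a::euclidean_space \<Rightarrow> real) \<Rightarrow> 'a \<Rightarrow> 'a" where
  "grad f x = (\<Sum>i\<in>Basis. frechet_derivative f (at x) i *\<^sub>R i)"

primrec k_times_cont_diff :: "nat \<Rightarrow> ('a::euclidean_space \<Rightarrow> real) \<Rightarrow> bool" where
  "k_times_cont_diff 0 f \<longleftrightarrow> continuous_on UNIV f"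
| "k_times_cont_diff (Suc k) f \<longleftrightarrow> (\<forall>x. f differentiable (at x)) \<and>
     (\<forall>i\<in>Basis. k_times_cont_diff k (\<lambda>x. frechet_derivative f (at x) i))"

definition test_function :: "'a::euclidean_space set \<Rightarrow> ('a \<Rightarrow> real) \<Rightarrow> bool" where
  "test_function \<Omega> \<phi> \<longleftrightarrow> (\<forall>k. k_times_cont_diff k \<phi>) \<and>
     compact (closure {x. \<phi> x \<noteq> 0}) \<and> closure {x. \<phi> x \<noteq> 0} \<subseteq> \<Omega>"

section \<open>Lebesgue and Sobolev spaces\<close>

text \<open>
  Elements of these spaces are represented by functions on the whole type, of which only the
  values on \<open>\<Omega>\<close> matter.
\<close>

definition in_Lp :: "real \<Rightarrow> 'a::euclidean_space set \<Rightarrow> ('a \<Rightarrow> 'b::euclidean_space) \<Rightarrow> bool" where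
  "in_Lp p \<Omega> f \<longleftrightarrow> f \<in> borel_measurable (lebesgue_on \<Omega>) \<and>
     integrable (lebesgue_on \<Omega>) (\<lambda>x. norm (f x) powr p)"

definition Lp_norm :: "real \<Rightarrow> 'a::euclidean_space set \<Rightarrow> ('a \<Rightarrow> 'b::euclidean_space) \<Rightarrow> real" where
  "Lp_norm p \<Omega> f = (LINT x|lebesgue_on \<Omega>. norm (f x) powr p) powr (1 / p)"

definition weak_gradient ::
    "'a::euclidean_space set \<Rightarrow> ('a \<Rightarrow> real) \<Rightarrow> ('a \<Rightarrow> 'a) \<Rightarrow> bool" where
  "weak_gradient \<Omega> u G \<longleftrightarrow> (\<forall>\<phi>. test_function \<Omega> \<phi> \<longrightarrow> (\<forall>i\<in>Basis.
     (LINT x|lebesgue_on \<Omega>. u x * (grad \<phi> x \<bullet> i)) = - (LINT x|lebesgue_on \<Omega>. (G x \<bullet> i) * \<phi> x)))"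

text \<open>\<open>in_W12_0 \<Omega> u G\<close>: \<open>u\<close> belongs to \<open>W\<^sub>0\<^sup>1\<^sup>,\<^sup>2(\<Omega>)\<close>, the closure of the test functions in
  \<open>W\<^sup>1\<^sup>,\<^sup>2(\<Omega>)\<close>, and its weak gradient is (represented by) \<open>G\<close>.\<close>

definition in_W12 :: "'a::euclidean_space set \<Rightarrow> ('a \<Rightarrow> real) \<Rightarrow> ('a \<Rightarrow> 'a) \<Rightarrow> bool" where
  "in_W12 \<Omega> u G \<longleftrightarrow> in_Lp 2 \<Omega> u \<and> in_Lp 2 \<Omega> G \<and> weak_gradient \<Omega> u G"

definition in_W12_0 :: "'a::euclidean_space set \<Rightarrow> ('a \<Rightarrow> real) \<Rightarrow> ('a \<Rightarrow> 'a) \<Rightarrow> bool" where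
  "in_W12_0 \<Omega> u G \<longleftrightarrow> in_W12 \<Omega> u G \<and>
     (\<exists>\<phi>. (\<forall>k::nat. test_function \<Omega> (\<phi> k)) \<and>
        (\<lambda>k. Lp_norm 2 \<Omega> (\<lambda>x. \<phi> k x - u x)) \<longlonglongrightarrow> 0 \<and>
        (\<lambda>k. Lp_norm 2 \<Omega> (\<lambda>x. grad (\<phi> k) x - G x)) \<longlonglongrightarrow> 0)"

text \<open>Weak solutions \<open>u \<in> W\<^sub>0\<^sup>1\<^sup>,\<^sup>2(\<Omega>)\<close> of \<open>\<Delta>u + V u = 0\<close> in \<open>\<Omega>\<close> that do not vanish almost
  everywhere.\<close>

definition nontrivial_dirichlet_solution ::
    "'a::euclidean_space set \<Rightarrow> ('a \<Rightarrow> real) \<Rightarrow> ('a \<Rightarrow> real) \<Rightarrow> bool" where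
  "nontrivial_dirichlet_solution \<Omega> V u \<longleftrightarrow>
     (\<exists>G. in_W12_0 \<Omega> u G \<and>
        (\<forall>\<phi>. test_function \<Omega> \<phi> \<longrightarrow>
           (LINT x|lebesgue_on \<Omega>. G x \<bullet> grad \<phi> x) = (LINT x|lebesgue_on \<Omega>. V x * u x * \<phi> x))) \<and>
     \<not> (AE x in lebesgue_on \<Omega>. u x = 0)"

section \<open>Domains with Dini continuous normal\<close>

text \<open>
  A graph function over the hyperplane orthogonal to the unit vector \<open>e\<close>, which plays the role
  of the \<open>x\<^sub>n\<close>-direction: the component \<open>x'\<close> of \<open>x\<close> is \<open>x - (x \<bullet> e) *\<^sub>R e\<close>, and only the values of
  \<open>\<phi>\<close> and of its gradient \<open>g\<close> on the hyperplane \<open>{x. x \<bullet> e = 0}\<close> are used.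
\<close>

definition C1_Dini_graph ::
    "real \<Rightarrow> (real \<Rightarrow> real) \<Rightarrow> 'a::euclidean_space \<Rightarrow> ('a \<Rightarrow> real) \<Rightarrow> bool" where
  "C1_Dini_graph L \<omega> e \<phi> \<longleftrightarrow>
     (\<exists>g. (\<forall>x\<in>{x. x \<bullet> e = 0}. g x \<bullet> e = 0 \<and>
              (\<phi> has_derivative (\<lambda>h. g x \<bullet> h)) (at x within {x. x \<bullet> e = 0})) \<and>
          \<phi> 0 = 0 \<and> g 0 = 0 \<and>
          (\<forall>x\<in>{x. x \<bullet> e = 0}. norm (g x) \<le> L) \<and>
          (\<forall>x\<in>{x. x \<bullet> e = 0}. \<forall>y\<in>{x. x \<bullet> e = 0}. norm (g x - g y) \<le> \<omega> (norm (x - y))))"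

definition C1_Dini_domain ::
    "'a::euclidean_space set \<Rightarrow> real \<Rightarrow> real \<Rightarrow> (real \<Rightarrow> real) \<Rightarrow> bool" where
  "C1_Dini_domain \<Omega> r\<^sub>\<Omega> L \<omega> \<longleftrightarrow>
     open \<Omega> \<and> bounded \<Omega> \<and> \<Omega> \<noteq> {} \<and>
     r\<^sub>\<Omega> > 0 \<and> (\<forall>t\<ge>0. \<omega> t \<ge> 0) \<and> mono_on {0..} \<omega> \<and>
     set_integrable lborel {0<..r\<^sub>\<Omega>} (\<lambda>t. \<omega> t / t) \<and>
     (\<forall>z\<in>frontier \<Omega>. \<exists>(T :: 'a \<Rightarrow> 'a) e \<phi>. orthogonal_transformation T \<and> e \<in> Basis \<and> C1_Dini_graph L \<omega> e \<phi> \<and>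
        (\<lambda>x. T (x - z)) ` \<Omega> \<inter> ball 0 r\<^sub>\<Omega> = {x. x \<bullet> e > \<phi> (x - (x \<bullet> e) *\<^sub>R e)} \<inter> ball 0 r\<^sub>\<Omega>)"

definition star_shape_radius :: "'a::euclidean_space set \<Rightarrow> (real \<Rightarrow> real) \<Rightarrow> real \<Rightarrow> bool" where
  "star_shape_radius \<Omega> \<omega> r\<^sub>s \<longleftrightarrow> r\<^sub>s > 0 \<and>
     (\<exists>C>0. \<forall>y\<in>closure \<Omega>. \<forall>r\<in>{0<..r\<^sub>s}. \<exists>z\<in>\<Omega>.
        dist z y \<le> C * r * \<omega> (C * r) \<and> C * r * \<omega> (C * r) \<le> r / 32 \<and>
        (\<forall>x\<in>\<Omega> \<inter> ball z (8 * r). closed_segment z x \<subseteq> \<Omega> \<inter> ball z (8 * r)))"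

section \<open>Doubling indices\<close>

text \<open>
  The logarithm to base \<open>b\<close> of \<open>a / c\<close> for \<open>a, c \<ge> 0\<close>. A vanishing denominator gives \<open>\<infinity>\<close> and not
  the value \<open>log b (a / 0) = 0\<close>, so that an upper bound entails that the denominator is nonzero.
\<close>

definition log_quotient :: "real \<Rightarrow> real \<Rightarrow> real \<Rightarrow> ereal" where
  "log_quotient b a c = (if c = 0 then \<infinity> else ereal (log b (a / c)))"

definition avg :: "'a::euclidean_space set \<Rightarrow> ('a \<Rightarrow> real) \<Rightarrow> real" where
  "avg E f = (LINT x|lebesgue_on E. f x) / measure lebesgue E"

definition dyadic_index :: "'a::euclidean_space set \<Rightarrow> ('a \<Rightarrow> real) \<Rightarrow> 'a \<Rightarrow> real \<Rightarrow> ereal" where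
  "dyadic_index \<Omega> u y r = log_quotient (exp 1)
     (LINT x|lebesgue_on (\<Omega> \<inter> ball y r). (u x)\<^sup>2)
     (LINT x|lebesgue_on (\<Omega> \<inter> ball y (r / 2)). (u x)\<^sup>2)"

definition doubling_index_at_scale :: "'a::euclidean_space set \<Rightarrow> real \<Rightarrow> ('a \<Rightarrow> real) \<Rightarrow> ereal" where
  "doubling_index_at_scale \<Omega> r u = (SUP y\<in>closure \<Omega>. log_quotient 4
     (avg (\<Omega> \<inter> ball y (2 * r)) (\<lambda>x. (u x)\<^sup>2))
     (avg (\<Omega> \<inter> ball y r) (\<lambda>x. (u x)\<^sup>2)))"

definition dyadic_recentering_scale :: "real \<Rightarrow> 'a::euclidean_space set \<Rightarrow> real \<Rightarrow> bool" where
  "dyadic_recentering_scale p \<Omega> r\<^sub>d \<longleftrightarrow> r\<^sub>d > 0 \<and>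
     (\<exists>C>0. \<forall>V u. in_Lp p \<Omega> V \<longrightarrow> nontrivial_dirichlet_solution \<Omega> V u \<longrightarrow>
        (\<forall>y\<in>closure \<Omega>. \<forall>r\<in>{0<..r\<^sub>d}.
           (SUP s\<in>{0<..r}. dyadic_index \<Omega> u y s) \<le>
             ereal C * (1 + ereal (Lp_norm p \<Omega> V powr (2 * p / (3 * p - 2 * real DIM('a))))
                          + dyadic_index \<Omega> u y (4 * r))))"

end

theory Submission
  imports Defs
begin

text \<open>
  Write \<open>m y r\<close> for the mass of \<open>u\<^sup>2\<close> in \<open>\<Omega> \<inter> ball y r\<close> and \<open>M\<close> for its mass in \<open>\<Omega>\<close>. A lower bound
  \<open>m y r\<^sub>d \<ge> exp (- K (1 + N)) M\<close>, where \<open>N\<close> is the power of the norm of the potential, bounds the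
  dyadic index at scale \<open>4 r\<^sub>d\<close> by \<open>K (1 + N)\<close>, hence through the recentering property also the index
  at scale \<open>r\<^sub>d\<close>. This gives a lower bound of the same form for \<open>m y (r\<^sub>d / 2)\<close>, and so for
  \<open>m z r\<^sub>d\<close> at every \<open>z\<close> with \<open>dist y z < r\<^sub>d / 2\<close>. Some ball of a finite cover carries a fixed fraction
  of \<open>M\<close>, and by connectedness every point is reached from its centre in a bounded number of such
  steps.
\<close>

section \<open>Finite nets and chains of bounded length in compact connected sets\<close>

lemma finite_net_compact:
  fixes S :: "'a::metric_space set"
  assumes "compact S" "e > 0"
  obtains F where "finite F" "F \<subseteq> S" "S \<subseteq> (\<Union>x\<in>F. ball x e)"
proof -
  have "S \<subseteq> (\<Union>x\<in>S. ball x e)"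
    using \<open>e > 0\<close> by auto
  then obtain F where "F \<subseteq> S" "finite F" "S \<subseteq> (\<Union>x\<in>F. ball x e)"
    using compactE_image[OF \<open>compact S\<close>, of S "\<lambda>x. ball x e"] by blast
  then show thesis
    using that by blast
qed

text \<open>Being joined by a chain of steps shorter than \<open>e\<close> is an equivalence
  relation with open classes, so connectedness leaves one class. Compactness makes the length
  uniform: take the longest of the chosen chains between centres of a finite net, plus one step at
  each end, whence the \<open>+ 2\<close>.\<close>

lemma connected_compact_chain_bound:
  fixes S :: "'a::metric_space set"
  assumes "connected S" "compact S" "e > 0"
  obtains N where "\<And>x y. x \<in> S \<Longrightarrow> y \<in> S \<Longrightarrow>
    \<exists>n\<le>N. (x, y) \<in> {(a, b). a \<in> S \<and> b \<in> S \<and> dist a b < e} ^^ n"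
proof -
  define R where "R = {(a, b). a \<in> S \<and> b \<in> S \<and> dist a b < e}"
  have "sym R"
    by (auto simp: R_def sym_def dist_commute)
  have chain: "(x, y) \<in> R\<^sup>*" if "x \<in> S" "y \<in> S" for x y
  proof (rule connected_equivalence_relation[OF assms(1) that, where R = "\<lambda>x y. (x, y) \<in> R\<^sup>*"])
    show "(y, x) \<in> R\<^sup>*" if "(x, y) \<in> R\<^sup>*" for x y
      using that \<open>sym R\<close> by (meson sym_rtrancl symD)
    show "(x, z) \<in> R\<^sup>*" if "(x, y) \<in> R\<^sup>*" "(y, z) \<in> R\<^sup>*" for x y z
      using that by auto
    show "\<exists>T. openin (top_of_set S) T \<and> a \<in> T \<and> (\<forall>x\<in>T. (a, x) \<in> R\<^sup>*)" if "a \<in> S" for a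
      using that \<open>e > 0\<close> by (intro exI[of _ "S \<inter> ball a e"]) (auto simp: R_def)
  qed
  obtain F where F: "finite F" "F \<subseteq> S" "S \<subseteq> (\<Union>x\<in>F. ball x e)"
    using finite_net_compact assms by metis
  have "\<forall>q\<in>F \<times> F. \<exists>n. q \<in> R ^^ n"
    using chain F(2) by (auto simp: rtrancl_power subset_iff)
  then obtain n where n: "\<And>q. q \<in> F \<times> F \<Longrightarrow> q \<in> R ^^ n q"
    by metis
  have "\<exists>k\<le>Max (n ` (F \<times> F)) + 2. (x, y) \<in> R ^^ k" if "x \<in> S" "y \<in> S" for x y
  proof -
    have "x \<in> (\<Union>f\<in>F. ball f e)" "y \<in> (\<Union>f\<in>F. ball f e)"
      using F(3) that by (blast dest: subsetD)+
    then obtain f g where fg: "f \<in> F" "g \<in> F" "dist f x < e" "dist g y < e"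
      by auto
    have "(x, f) \<in> R" "(g, y) \<in> R"
      using fg F(2) that by (auto simp: R_def dist_commute)
    then have "(x, y) \<in> R ^^ Suc (Suc (n (f, g)))"
      using n[of "(f, g)"] fg by (meson SigmaI relpow_Suc_I relpow_Suc_I2)
    moreover have "n (f, g) \<le> Max (n ` (F \<times> F))"
      using fg F(1) by (intro Max_ge) auto
    ultimately show ?thesis
      by (intro exI[of _ "Suc (Suc (n (f, g)))"]) simp
  qed
  then show thesis
    using that unfolding R_def by blast
qed

section \<open>Integrals over subsets and covers, and positivity of measure\<close>

lemma lebesgue_on_integral_mono_set:
  fixes f :: "'a::euclidean_space \<Rightarrow> real"
  assumes "integrable (lebesgue_on C) f" "\<And>x. x \<in> C \<Longrightarrow> f x \<ge> 0"
    and "A \<subseteq> B" "B \<subseteq> C" "A \<in> sets lebesgue" "B \<in> sets lebesgue" "C \<in> sets lebesgue"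
  shows "(LINT x|lebesgue_on A. f x) \<le> (LINT x|lebesgue_on B. f x)"
proof -
  have C: "set_integrable lebesgue C f"
    using assms by (simp add: integrable_restrict_space set_integrable_def)
  then have "set_integrable lebesgue A f" "set_integrable lebesgue B f"
    using assms by (auto intro: set_integrable_subset[OF C])
  then have "(LINT x:A|lebesgue. f x) \<le> (LINT x:B|lebesgue. f x)"
    unfolding set_lebesgue_integral_def set_integrable_def
    using assms(2-4) by (intro integral_mono) (auto simp: indicator_def)
  then show ?thesis
    using assms by (simp add: integral_restrict_space set_lebesgue_integral_def)
qed

text \<open>The sets \<open>A i\<close> may overlap: the sum of their indicators is at least 1 on
  \<open>B\<close>, and \<open>f\<close> is nonnegative there.\<close>

lemma lebesgue_on_integral_le_sum_cover:
  fixes f :: "'a::euclidean_space \<Rightarrow> real"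
  assumes "integrable (lebesgue_on B) f" "\<And>x. x \<in> B \<Longrightarrow> f x \<ge> 0" "B \<in> sets lebesgue"
    and "finite I" "\<And>i. i \<in> I \<Longrightarrow> A i \<in> sets lebesgue" "\<And>i. i \<in> I \<Longrightarrow> A i \<subseteq> B"
    and "B \<subseteq> (\<Union>i\<in>I. A i)"
  shows "(LINT x|lebesgue_on B. f x) \<le> (\<Sum>i\<in>I. LINT x|lebesgue_on (A i). f x)"
proof -
  have B: "set_integrable lebesgue B f"
    using assms by (simp add: integrable_restrict_space set_integrable_def)
  then have A: "set_integrable lebesgue (A i) f" if "i \<in> I" for i
    using assms that by (intro set_integrable_subset[OF B]) auto
  have "(LINT x:B|lebesgue. f x) \<le> (LINT x|lebesgue. (\<Sum>i\<in>I. indicator (A i) x *\<^sub>R f x))"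
    unfolding set_lebesgue_integral_def
  proof (rule integral_mono)
    show "integrable lebesgue (\<lambda>x. indicator B x *\<^sub>R f x)"
      using B by (simp add: set_integrable_def)
    show "integrable lebesgue (\<lambda>x. \<Sum>i\<in>I. indicator (A i) x *\<^sub>R f x)"
      using A by (simp add: set_integrable_def)
    show "indicator B x *\<^sub>R f x \<le> (\<Sum>i\<in>I. indicator (A i) x *\<^sub>R f x)" for x
    proof (cases "x \<in> B")
      case True
      then obtain j where j: "j \<in> I" "x \<in> A j"
        using assms(7) by auto
      have "indicator (A j) x *\<^sub>R f x \<le> (\<Sum>i\<in>I. indicator (A i) x *\<^sub>R f x)"
        using j(1) assms(2)[OF True] by (intro member_le_sum assms(4)) auto
      then show ?thesis
        using j True by simp
    next
      case False
      then have "x \<notin> A i" if "i \<in> I" for i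
        using assms(6) that by blast
      then show ?thesis
        using False by simp
    qed
  qed
  also have "\<dots> = (\<Sum>i\<in>I. LINT x:A i|lebesgue. f x)"
    using A unfolding set_lebesgue_integral_def set_integrable_def by (rule Bochner_Integration.integral_sum)
  finally show ?thesis
    using assms by (simp add: integral_restrict_space set_lebesgue_integral_def)
qed

lemma measure_lebesgue_open_pos:
  fixes S :: "'a::euclidean_space set"
  assumes "open S" "bounded S" "S \<noteq> {}"
  shows "measure lebesgue S > 0"
  using open_not_negligible[OF assms(1,3)] negligible_iff_measure lmeasurable_open[OF assms(2,1)]
  by (metis measure_nonneg order_le_less)

section \<open>Doubling indices as mass inequalities, and propagation of mass\<close>

text \<open>Positivity of \<open>a\<close> settles the case \<open>c = 0\<close>, where both sides
  are false: the left compares infinity with a real, the right says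
  \<open>a \<le> 0\<close>.\<close>

lemma log_quotient_le_ereal_iff:
  assumes "b > 1" "a > 0" "c \<ge> 0"
  shows "log_quotient b a c \<le> ereal t \<longleftrightarrow> a \<le> b powr t * c"
proof (cases "c = 0")
  case False
  then have "log b (a / c) \<le> t \<longleftrightarrow> a / c \<le> b powr t"
    using assms by (simp add: log_le_iff)
  also have "\<dots> \<longleftrightarrow> a \<le> b powr t * c"
    using False assms by (simp add: field_simps)
  finally show ?thesis
    using False by (simp add: log_quotient_def)
qed (use assms in \<open>auto simp: log_quotient_def\<close>)

lemma exp_minus_mult_le_iff: "exp (- t) * a \<le> b \<longleftrightarrow> a \<le> exp t * b" for a b t :: real
  by (simp add: exp_minus field_simps)

text \<open>One link of the chain. The new exponent is the old one plus the bound
  \<open>C * (1 + K) * (1 + N)\<close> on the index at scale \<open>r\<close>, so the constant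
  changes by a rule free of \<open>N\<close>, and the dependence on \<open>N\<close> stays linear
  over any number of links.\<close>

lemma mass_recentering_step:
  fixes \<Omega> :: "'a::euclidean_space set" and u :: "'a \<Rightarrow> real"
  defines "m \<equiv> \<lambda>y s. LINT x|lebesgue_on (\<Omega> \<inter> ball y s). (u x)\<^sup>2"
    and "M \<equiv> LINT x|lebesgue_on \<Omega>. (u x)\<^sup>2"
  assumes \<Omega>: "open \<Omega>" and u: "integrable (lebesgue_on \<Omega>) (\<lambda>x. (u x)\<^sup>2)" and "M > 0"
    and nonneg: "r > 0" "C > 0" "N \<ge> 0" "K \<ge> 0"
    and index: "dyadic_index \<Omega> u y r \<le> ereal C * (1 + ereal N + dyadic_index \<Omega> u y (4 * r))"
    and mass: "m y r \<ge> exp (- (K * (1 + N))) * M"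
    and "dist y z < r / 2"
  shows "m z r \<ge> exp (- ((K + C * (1 + K)) * (1 + N))) * M"
proof -
  have sets: "\<Omega> \<inter> ball a s \<in> sets lebesgue" "\<Omega> \<in> sets lebesgue" for a s
    using \<Omega> by auto
  have mono: "m a s \<le> m b t" if "\<Omega> \<inter> ball a s \<subseteq> \<Omega> \<inter> ball b t" for a s b t
    unfolding m_def using that by (intro lebesgue_on_integral_mono_set[OF u] sets) auto
  have le_M: "m a s \<le> M" for a s
    unfolding m_def M_def by (intro lebesgue_on_integral_mono_set[OF u] sets) auto
  have "m y r > 0"
    using mass \<open>M > 0\<close> by (meson exp_gt_zero less_le_trans mult_pos_pos)
  \<comment> \<open>The index at scale \<open>4 * r\<close> has the mass at radius
    \<open>2 * r\<close> in its denominator, so the lower bound at radius \<open>r\<close> is passed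
    on to the larger ball.\<close>
  have "m y r \<le> m y (2 * r)" "m y (2 * r) \<le> m y (4 * r)"
    using nonneg by (auto intro!: mono)
  moreover have "M \<le> exp (K * (1 + N)) * m y r"
    using mass by (simp add: exp_minus_mult_le_iff)
  ultimately have "m y (4 * r) \<le> exp (K * (1 + N)) * m y (2 * r)"
    using le_M[of y "4 * r"] by (smt (verit) exp_gt_zero mult_left_mono)
  then have "dyadic_index \<Omega> u y (4 * r) \<le> ereal (K * (1 + N))"
    using \<open>m y r > 0\<close> \<open>m y r \<le> m y (2 * r)\<close> \<open>m y (2 * r) \<le> m y (4 * r)\<close>
    unfolding dyadic_index_def by (subst log_quotient_le_ereal_iff) (auto simp: m_def exp_powr_real)
  then have "ereal C * (1 + ereal N + dyadic_index \<Omega> u y (4 * r))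
      \<le> ereal C * (1 + ereal N + ereal (K * (1 + N)))"
    using nonneg by (intro ereal_mult_left_mono add_mono) auto
  \<comment> \<open>The summand 1 in the recentering estimate allows the factorization
    \<open>1 + N + K * (1 + N) = (1 + K) * (1 + N)\<close>.\<close>
  also have "\<dots> = ereal (C * (1 + K) * (1 + N))"
    by (simp add: one_ereal_def algebra_simps)
  finally have "dyadic_index \<Omega> u y r \<le> ereal (C * (1 + K) * (1 + N))"
    using index by order
  then have "m y r \<le> exp (C * (1 + K) * (1 + N)) * m y (r / 2)"
    using \<open>m y r > 0\<close> unfolding dyadic_index_def
    by (subst (asm) log_quotient_le_ereal_iff) (auto simp: m_def exp_powr_real)
  moreover have "m y (r / 2) \<le> m z r"
  proof (rule mono)
    have "ball y (r / 2) \<subseteq> ball z r"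
    proof
      fix x assume "x \<in> ball y (r / 2)"
      then show "x \<in> ball z r"
        using \<open>dist y z < r / 2\<close> dist_triangle[of z x y] by (simp add: dist_commute)
    qed
    then show "\<Omega> \<inter> ball y (r / 2) \<subseteq> \<Omega> \<inter> ball z r"
      by auto
  qed
  ultimately have "exp (- (K * (1 + N))) * M \<le> exp (C * (1 + K) * (1 + N)) * m z r"
    using mass by (smt (verit) exp_gt_zero mult_left_mono)
  then have "exp (- (C * (1 + K) * (1 + N))) * (exp (- (K * (1 + N))) * M) \<le> m z r"
    by (simp only: exp_minus_mult_le_iff)
  moreover have "- ((K + C * (1 + K)) * (1 + N)) = - (C * (1 + K) * (1 + N)) + - (K * (1 + N))"
    by (simp add: algebra_simps)
  ultimately show ?thesis
    by (simp only: exp_add mult.assoc)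
qed

lemma nontrivial_dirichlet_solution_mass:
  assumes "nontrivial_dirichlet_solution \<Omega> V u"
  shows "integrable (lebesgue_on \<Omega>) (\<lambda>x. (u x)\<^sup>2)" "(LINT x|lebesgue_on \<Omega>. (u x)\<^sup>2) > 0"
proof -
  have "in_Lp 2 \<Omega> u" "\<not> (AE x in lebesgue_on \<Omega>. u x = 0)"
    using assms by (auto simp: nontrivial_dirichlet_solution_def in_W12_0_def in_W12_def)
  moreover show int: "integrable (lebesgue_on \<Omega>) (\<lambda>x. (u x)\<^sup>2)"
    using \<open>in_Lp 2 \<Omega> u\<close> by (simp add: in_Lp_def)
  ultimately have "(LINT x|lebesgue_on \<Omega>. (u x)\<^sup>2) \<noteq> 0"
    by (subst integral_nonneg_eq_0_iff_AE[OF int]) auto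
  moreover have "(LINT x|lebesgue_on \<Omega>. (u x)\<^sup>2) \<ge> 0"
    by (rule Bochner_Integration.integral_nonneg) simp
  ultimately show "(LINT x|lebesgue_on \<Omega>. (u x)\<^sup>2) > 0"
    by (simp add: order_less_le)
qed

section \<open>The doubling bound uniformly over the closure of the domain\<close>

theorem lemma2p10:
  fixes \<Omega> :: "(real ^ 'n) set" and p r\<^sub>\<Omega> L r\<^sub>s r\<^sub>d :: real and \<omega> :: "real \<Rightarrow> real"
  assumes "CARD('n) \<ge> 2"
    and "p > real CARD('n)"
    and "connected \<Omega>"
    and "C1_Dini_domain \<Omega> r\<^sub>\<Omega> L \<omega>"
    and "star_shape_radius \<Omega> \<omega> r\<^sub>s"
    and "dyadic_recentering_scale p \<Omega> r\<^sub>d"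
    and "r\<^sub>d / 32 \<le> r\<^sub>s"
    and "r\<^sub>d / 4 \<le> 1"
  shows "\<exists>C>0. \<forall>V u. in_Lp p \<Omega> V \<longrightarrow> nontrivial_dirichlet_solution \<Omega> V u \<longrightarrow>
    doubling_index_at_scale \<Omega> (2 * r\<^sub>d) u
      \<le> ereal (C * (1 + Lp_norm p \<Omega> V powr (2 * p / (3 * p - 2 * real CARD('n)))))"
proof -
  have \<Omega>: "open \<Omega>" "bounded \<Omega>" "\<Omega> \<noteq> {}"
    using assms(4) by (auto simp: C1_Dini_domain_def)
  define N where "N V = Lp_norm p \<Omega> V powr (2 * p / (3 * p - 2 * real CARD('n)))" for V :: "real ^ 'n \<Rightarrow> real"
  have N: "N V \<ge> 0" for V
    by (simp add: N_def)
  obtain C where "C > 0" "r\<^sub>d > 0" and recentering: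
    "\<And>V u y r. in_Lp p \<Omega> V \<Longrightarrow> nontrivial_dirichlet_solution \<Omega> V u \<Longrightarrow> y \<in> closure \<Omega> \<Longrightarrow>
      r \<in> {0<..r\<^sub>d} \<Longrightarrow> (SUP s\<in>{0<..r}. dyadic_index \<Omega> u y s)
        \<le> ereal C * (1 + ereal (N V) + dyadic_index \<Omega> u y (4 * r))"
    using assms(6) unfolding dyadic_recentering_scale_def N_def by auto
  have index: "dyadic_index \<Omega> u y r\<^sub>d \<le> ereal C * (1 + ereal (N V) + dyadic_index \<Omega> u y (4 * r\<^sub>d))"
    if "in_Lp p \<Omega> V" "nontrivial_dirichlet_solution \<Omega> V u" "y \<in> closure \<Omega>" for V u y
    \<comment> \<open>The supremum over scales up to \<open>r\<^sub>d\<close> includes the scale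
      \<open>r\<^sub>d\<close> itself.\<close>
    using SUP_upper[of r\<^sub>d "{0<..r\<^sub>d}" "dyadic_index \<Omega> u y"] recentering[OF that, of r\<^sub>d] \<open>r\<^sub>d > 0\<close> by simp
  have closure: "compact (closure \<Omega>)" "connected (closure \<Omega>)" "closure \<Omega> \<noteq> {}"
    using \<Omega> assms(3) by (auto simp: connected_imp_connected_closure)
  define R where "R = {(a, b). a \<in> closure \<Omega> \<and> b \<in> closure \<Omega> \<and> dist a b < r\<^sub>d / 2}"
  have "r\<^sub>d / 2 > 0"
    using \<open>r\<^sub>d > 0\<close> by simp
  then obtain J where J: "\<And>x y. x \<in> closure \<Omega> \<Longrightarrow> y \<in> closure \<Omega> \<Longrightarrow> \<exists>j\<le>J. (x, y) \<in> R ^^ j"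
    unfolding R_def by (rule connected_compact_chain_bound[OF closure(2,1)]) blast
  obtain F where F: "finite F" "F \<subseteq> closure \<Omega>" "closure \<Omega> \<subseteq> (\<Union>x\<in>F. ball x r\<^sub>d)"
    using finite_net_compact[OF closure(1) \<open>r\<^sub>d > 0\<close>] .
  have "F \<noteq> {}"
    using F closure(3) by auto
  then have "card F \<ge> 1"
    using F(1) by (simp add: Suc_le_eq card_gt_0_iff)
  \<comment> \<open>\<open>K j\<close> is the exponent after \<open>j\<close> links:
    \<open>ln (card F)\<close> comes from the pigeonhole choice of the starting ball, the recursion
    from \<open>mass_recentering_step\<close>. As \<open>C\<close>, \<open>F\<close> and
    \<open>J\<close> are fixed before \<open>V\<close> and \<open>u\<close>, the constant
    \<open>K J\<close> is uniform in both.\<close>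
  define K where "K = rec_nat (ln (card F)) (\<lambda>_ k. k + C * (1 + k))"
  have K_0: "K 0 = ln (card F)" and K_Suc: "K (Suc j) = K j + C * (1 + K j)" for j
    by (simp_all add: K_def)
  have K_nonneg: "K j \<ge> 0" for j
    using \<open>card F \<ge> 1\<close> \<open>C > 0\<close> by (induction j) (auto simp: K_0 K_Suc)
  have "K j \<le> K (Suc j)" for j
    using \<open>C > 0\<close> K_nonneg[of j] by (simp add: K_Suc)
  then have K_mono: "i \<le> j \<Longrightarrow> K i \<le> K j" for i j
    by (rule lift_Suc_mono_le)
  have bound: "doubling_index_at_scale \<Omega> (2 * r\<^sub>d) u \<le> ereal (K J / ln 4 * (1 + N V))"
    if V: "in_Lp p \<Omega> V" and u: "nontrivial_dirichlet_solution \<Omega> V u" for V u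
  proof -
    define m where "m y s = (LINT x|lebesgue_on (\<Omega> \<inter> ball y s). (u x)\<^sup>2)" for y s
    define M where "M = (LINT x|lebesgue_on \<Omega>. (u x)\<^sup>2)"
    note int = nontrivial_dirichlet_solution_mass(1)[OF u]
    have "M > 0"
      using nontrivial_dirichlet_solution_mass(2)[OF u] by (simp add: M_def)
    have sets: "\<Omega> \<inter> ball a s \<in> sets lebesgue" "\<Omega> \<in> sets lebesgue" for a s
      using \<Omega> by auto
    have "M \<le> (\<Sum>f\<in>F. m f r\<^sub>d)"
      unfolding M_def m_def using F closure_subset[of \<Omega>]
      by (intro lebesgue_on_integral_le_sum_cover int sets) auto
    \<comment> \<open>Pigeonhole: if every ball carried less than \<open>M / card F\<close>, the sum
      would be below \<open>M\<close>.\<close>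
    then have "\<exists>f\<in>F. M / card F \<le> m f r\<^sub>d"
      using sum_bounded_above_strict[of F "\<lambda>f. m f r\<^sub>d" "M / card F"] \<open>card F \<ge> 1\<close>
      by (fastforce simp: not_le)
    then obtain f where f: "f \<in> F" "M / card F \<le> m f r\<^sub>d"
      by blast
    \<comment> \<open>The factor \<open>1 + N V \<ge> 1\<close> only weakens the starting bound and
      gives it the form kept along the chain.\<close>
    have "exp (- (K 0 * (1 + N V))) \<le> exp (- K 0)"
      using K_nonneg[of 0] N[of V] by (simp add: algebra_simps)
    also have "\<dots> = 1 / card F"
      using \<open>card F \<ge> 1\<close> by (simp add: K_0 exp_minus inverse_eq_divide)
    finally have "exp (- (K 0 * (1 + N V))) * M \<le> 1 / card F * M"
      using \<open>M > 0\<close> by (intro mult_right_mono) auto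
    then have start: "exp (- (K 0 * (1 + N V))) * M \<le> m f r\<^sub>d"
      using f(2) by simp
    have chain: "exp (- (K j * (1 + N V))) * M \<le> m y r\<^sub>d" if "(f, y) \<in> R ^^ j" for j y
      using that
    proof (induction j arbitrary: y)
      case 0
      then show ?case
        using start by simp
    next
      case (Suc j)
      then obtain x where x: "(f, x) \<in> R ^^ j" "(x, y) \<in> R"
        by (meson relpow_Suc_E)
      then have "x \<in> closure \<Omega>" "dist x y < r\<^sub>d / 2"
        by (auto simp: R_def)
      then show ?case
        using mass_recentering_step[OF \<Omega>(1) int _ \<open>r\<^sub>d > 0\<close> \<open>C > 0\<close> N K_nonneg index[OF V u], of x j y]
          Suc.IH[OF x(1)] \<open>M > 0\<close> by (simp add: K_Suc M_def m_def)
    qed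
    show ?thesis
      unfolding doubling_index_at_scale_def
    proof (rule SUP_least)
      fix y assume y: "y \<in> closure \<Omega>"
      let ?inner = "\<Omega> \<inter> ball y (2 * r\<^sub>d)" and ?outer = "\<Omega> \<inter> ball y (4 * r\<^sub>d)"
      obtain j where j: "j \<le> J" "(f, y) \<in> R ^^ j"
        using J f(1) F(2) y by blast
      \<comment> \<open>The length \<open>j\<close> depends on \<open>y\<close>; monotonicity of
        \<open>K\<close> replaces it by the common bound \<open>J\<close>.\<close>
      have "exp (- (K J * (1 + N V))) * M \<le> exp (- (K j * (1 + N V))) * M"
        using K_mono[OF j(1)] N[of V] \<open>M > 0\<close> by (intro mult_right_mono) (auto intro: mult_right_mono)
      also have "\<dots> \<le> m y r\<^sub>d"
        by (rule chain[OF j(2)])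
      also have "m y r\<^sub>d \<le> m y (2 * r\<^sub>d)"
        unfolding m_def using \<open>r\<^sub>d > 0\<close>
        by (intro lebesgue_on_integral_mono_set[OF int] sets) auto
      finally have inner: "exp (- (K J * (1 + N V))) * M \<le> m y (2 * r\<^sub>d)" .
      then have "m y (2 * r\<^sub>d) > 0"
        using \<open>M > 0\<close> by (meson exp_gt_zero less_le_trans mult_pos_pos)
      have "m y (2 * r\<^sub>d) \<le> m y (4 * r\<^sub>d)" "m y (4 * r\<^sub>d) \<le> M"
        unfolding m_def M_def using \<open>r\<^sub>d > 0\<close>
        by (auto intro!: lebesgue_on_integral_mono_set[OF int] sets)
      \<comment> \<open>Since \<open>y\<close> may lie on the boundary, positive measure of the
        inner set comes from an open ball about a point of the closure meeting
        \<open>\<Omega>\<close>.\<close>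
      have "y \<in> ball y (2 * r\<^sub>d) \<inter> closure \<Omega>"
        using y \<open>r\<^sub>d > 0\<close> by simp
      then have "\<Omega> \<inter> ball y (2 * r\<^sub>d) \<noteq> {}"
        using open_Int_closure_eq_empty[OF open_ball, of y "2 * r\<^sub>d" \<Omega>]
        by (metis Int_commute empty_iff)
      then have inner_pos: "measure lebesgue ?inner > 0"
        using \<Omega> by (intro measure_lebesgue_open_pos) auto
      have inner_outer: "measure lebesgue ?inner \<le> measure lebesgue ?outer"
        using \<Omega> \<open>r\<^sub>d > 0\<close> by (intro measure_mono_fmeasurable lmeasurable_open) auto
      \<comment> \<open>Passing from masses to averages costs nothing: the outer set has the larger
        measure, so dividing by the inner measure instead only increases the quotient.\<close>
      then have "m y (4 * r\<^sub>d) / measure lebesgue ?outer \<le> m y (4 * r\<^sub>d) / measure lebesgue ?inner"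
        using inner_pos \<open>m y (2 * r\<^sub>d) > 0\<close> \<open>m y (2 * r\<^sub>d) \<le> m y (4 * r\<^sub>d)\<close>
        by (intro divide_left_mono mult_pos_pos) auto
      also have "m y (4 * r\<^sub>d) \<le> exp (K J * (1 + N V)) * m y (2 * r\<^sub>d)"
        using inner \<open>m y (4 * r\<^sub>d) \<le> M\<close> by (simp add: exp_minus_mult_le_iff)
      then have "m y (4 * r\<^sub>d) / measure lebesgue ?inner
          \<le> exp (K J * (1 + N V)) * (m y (2 * r\<^sub>d) / measure lebesgue ?inner)"
        using inner_pos by (simp add: divide_right_mono)
      \<comment> \<open>The change from base e to base 4 produces the factor \<open>1 / ln 4\<close>
        in the constant.\<close>
      also have "exp (K J * (1 + N V)) = 4 powr (K J / ln 4 * (1 + N V))"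
        by (simp add: powr_def)
      finally have "avg ?outer (\<lambda>x. (u x)\<^sup>2)
          \<le> 4 powr (K J / ln 4 * (1 + N V)) * avg ?inner (\<lambda>x. (u x)\<^sup>2)"
        by (simp add: avg_def m_def)
      moreover have "avg ?outer (\<lambda>x. (u x)\<^sup>2) > 0"
        using inner_pos inner_outer \<open>m y (2 * r\<^sub>d) > 0\<close> \<open>m y (2 * r\<^sub>d) \<le> m y (4 * r\<^sub>d)\<close>
        by (simp add: avg_def m_def)
      moreover have "avg ?inner (\<lambda>x. (u x)\<^sup>2) \<ge> 0"
        using inner_pos \<open>m y (2 * r\<^sub>d) > 0\<close> by (simp add: avg_def m_def)
      ultimately show "log_quotient 4 (avg (\<Omega> \<inter> ball y (2 * (2 * r\<^sub>d))) (\<lambda>x. (u x)\<^sup>2))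
          (avg ?inner (\<lambda>x. (u x)\<^sup>2)) \<le> ereal (K J / ln 4 * (1 + N V))"
        by (subst log_quotient_le_ereal_iff) simp_all
    qed
  qed
  show ?thesis
  \<comment> \<open>\<open>K J\<close> is only known to be nonnegative; adding 1 makes the constant
    strictly positive.\<close>
  proof (intro exI[of _ "K J / ln 4 + 1"] conjI allI impI)
    show "K J / ln 4 + 1 > 0"
      using K_nonneg[of J] by (simp add: add_nonneg_pos)
    show "doubling_index_at_scale \<Omega> (2 * r\<^sub>d) u
        \<le> ereal ((K J / ln 4 + 1) * (1 + Lp_norm p \<Omega> V powr (2 * p / (3 * p - 2 * real CARD('n)))))"
      if "in_Lp p \<Omega> V" "nontrivial_dirichlet_solution \<Omega> V u" for V u
    proof -
      have "K J / ln 4 * (1 + N V) \<le> (K J / ln 4 + 1) * (1 + N V)"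
        using N[of V] by (intro mult_right_mono) auto
      then show ?thesis
        using bound[OF that] unfolding N_def by (meson ereal_less_eq(3) order_trans)
    qed
  qed
qed

end
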